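(* Suppose that $F$ is an $r$-graph and $P$ is a minimal pattern such that $(F,P)$ is a Turán pair. Then $\mathrm{ex}(n,F)$ is $4\binom{n-1}{r-2}$-smooth, that is, \[ \left|\delta(n,F) - d(n-1,F)\right| \le 4\binom{n-1}{r-2} \] for every integer $n\ge 2$.
   Context: An $r$-graph is a collection of $r$-subsets (edges) of a finite vertex set. $\mathrm{ex}(n,F)$ is the maximum number of edges of an $n$-vertex $r$-graph not containing $F$; $d(n,F):=r\cdot\mathrm{ex}(n,F)/n$ and $\delta(n,F):=\mathrm{ex}(n,F)-\mathrm{ex}(n-1,F)$. An $r$-multiset is an unordered collection of $r$ elements with repetitions allowed. A pattern is a pair $P=(k,E)$ with $k$ a positive integer and $E$ a collection of $r$-multisets on $[k]$. Given disjoint sets $V_1,\dots,V_k$, the profile of an $r$-set $X\subseteq V_1\cup\dots\cup V_k$ is the $r$-multiset on $[k]$ containing $i$ with multiplicity $|X\cap V_i|$; an $r$-graph $\mathcal{G}$ is a $P$-construction on $V$ if there is a partition $V=V_1\cup\dots\cup V_k$ such that $\mathcal{G}$ consists exactly of all $r$-subsets of $V$ whose profile lies in $E$. A $P$-subconstruction is a subgraph of a $P$-construction. $\Lambda(P,n)$ is the maximum number of edges of an $n$-vertex $P$-construction and $\lambda(P)=\lim_{n\to\infty}\Lambda(P,n)/\binom{n}{r}$. For $i\in[k]$, $P-i$ is the pattern obtained by removing $i$ from $[k]$ and all multisets containing $i$ from $E$. $P$ is minimal if $\lambda(P-i)<\lambda(P)$ for all $i\in[k]$. $(F,P)$ is a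 Turán pair if every $P$-construction is $F$-free and every $F$-free $r$-graph with $\mathrm{ex}(n,F)$ edges on $n$ vertices (for every $n$) is a $P$-construction. *)

theory Defs
  imports Complex_Main "HOL-Library.Multiset" "HOL-Library.Disjoint_Sets"
begin

text \<open>A hypergraph is a pair of its vertex set and its edge set; isolated vertices are allowed.\<close>

type_synonym 'v hgraph = "'v set \<times> 'v set set"

definition is_rgraph :: "nat \<Rightarrow> 'v hgraph \<Rightarrow> bool" where
  "is_rgraph r G \<longleftrightarrow> finite (fst G) \<and> (\<forall>e\<in>snd G. e \<subseteq> fst G \<and> card e = r)"

text \<open>Containment is containment as a (not necessarily induced) subgraph, up to renaming of
  vertices.\<close>

definition contains_copy :: "'w hgraph \<Rightarrow> 'v hgraph \<Rightarrow> bool" where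
  "contains_copy G F \<longleftrightarrow>
     (\<exists>f. inj_on f (fst F) \<and> f ` fst F \<subseteq> fst G \<and> (\<forall>e\<in>snd F. f ` e \<in> snd G))"

abbreviation is_free :: "'v hgraph \<Rightarrow> 'w hgraph \<Rightarrow> bool" where
  "is_free F G \<equiv> \<not> contains_copy G F"

text \<open>All host hypergraphs have natural numbers as vertices, which loses nothing up to
  isomorphism. The maximum is written as a supremum in the naturals, so that it is 0 (instead of
  unspecified) if there is no admissible hypergraph.\<close>

definition ex_number :: "nat \<Rightarrow> 'v hgraph \<Rightarrow> nat \<Rightarrow> nat" where
  "ex_number r F n =
     Sup {card (snd G) | G :: nat hgraph. is_rgraph r G \<and> card (fst G) = n \<and> is_free F G}"

definition avg_deg :: "nat \<Rightarrow> 'v hgraph \<Rightarrow> nat \<Rightarrow> real" where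
  "avg_deg r F n = real r * real (ex_number r F n) / real n"

text \<open>Only used for positive arguments.\<close>

definition ex_diff :: "nat \<Rightarrow> 'v hgraph \<Rightarrow> nat \<Rightarrow> real" where
  "ex_diff r F n = real (ex_number r F n) - real (ex_number r F (n - 1))"

text \<open>A pattern carries its index set rather than its cardinality, since removing
  an index from the set \<open>{1..k}\<close> does not give an initial segment in general.\<close>

type_synonym pattern = "nat set \<times> nat multiset set"

definition is_pattern :: "nat \<Rightarrow> pattern \<Rightarrow> bool" where
  "is_pattern r P \<longleftrightarrow> finite (fst P) \<and> (\<forall>M\<in>snd P. size M = r \<and> set_mset M \<subseteq> fst P)"

definition profile :: "nat set \<Rightarrow> (nat \<Rightarrow> 'v set) \<Rightarrow> 'v set \<Rightarrow> nat multiset" where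
  "profile I W X = (\<Sum>i\<in>I. replicate_mset (card (X \<inter> W i)) i)"

text \<open>The parts of the partition may be empty.\<close>

definition is_construction :: "nat \<Rightarrow> pattern \<Rightarrow> 'v hgraph \<Rightarrow> bool" where
  "is_construction r P G \<longleftrightarrow> finite (fst G) \<and>
     (\<exists>W. disjoint_family_on W (fst P) \<and> (\<Union>i\<in>fst P. W i) = fst G \<and>
          snd G = {X. X \<subseteq> fst G \<and> card X = r \<and> profile (fst P) W X \<in> snd P})"

text \<open>For an empty index set there is no construction on \<open>n > 0\<close> vertices; the
  supremum is then 0, and hence so is the density.\<close>

definition pattern_max :: "nat \<Rightarrow> pattern \<Rightarrow> nat \<Rightarrow> nat" where
  "pattern_max r P n =
     Sup {card (snd G) | G :: nat hgraph. is_construction r P G \<and> card (fst G) = n}"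

definition pattern_density :: "nat \<Rightarrow> pattern \<Rightarrow> real" where
  "pattern_density r P = lim (\<lambda>n. real (pattern_max r P n) / real (n choose r))"

definition pattern_delete :: "pattern \<Rightarrow> nat \<Rightarrow> pattern" where
  "pattern_delete P i = (fst P - {i}, {M \<in> snd P. i \<notin># M})"

definition minimal_pattern :: "nat \<Rightarrow> pattern \<Rightarrow> bool" where
  "minimal_pattern r P \<longleftrightarrow>
     (\<forall>i\<in>fst P. pattern_density r (pattern_delete P i) < pattern_density r P)"

definition turan_pair :: "nat \<Rightarrow> 'v hgraph \<Rightarrow> pattern \<Rightarrow> bool" where
  "turan_pair r F P \<longleftrightarrow>
     (\<forall>G :: nat hgraph. is_construction r P G \<longrightarrow> is_free F G) \<and>
     (\<forall>G :: nat hgraph. is_rgraph r G \<and> is_free F G \<and>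
        card (snd G) = ex_number r F (card (fst G)) \<longrightarrow> is_construction r P G)"

end

theory Submission
  imports Defs
begin

text \<open>
  For the lower bound, duplicate a vertex of maximum degree in an extremal construction on
  \<open>n - 1\<close> vertices: the result is again a construction, hence free, so
  \<open>\<delta>(n) \<ge> d(n - 1)\<close>. For the upper bound, average over all vertex deletions from an extremal
  hypergraph on \<open>n\<close> vertices: \<open>(n - r) ex(n) \<le> n ex(n - 1)\<close>, which together with
  \<open>ex(n - 1) \<le> (n - 1 choose r)\<close> gives \<open>\<delta>(n) \<le> d(n - 1) + (n - 2 choose r - 2)\<close>.
\<close>

section \<open>Degrees and vertex deletion\<close>

definition degree :: "'v hgraph \<Rightarrow> 'v \<Rightarrow> nat" where
  "degree G v = card {e \<in> snd G. v \<in> e}"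

definition delete_vertex :: "'v hgraph \<Rightarrow> 'v \<Rightarrow> 'v hgraph" where
  "delete_vertex G v = (fst G - {v}, {e \<in> snd G. v \<notin> e})"

lemma rgraph_finite_edges:
  assumes "is_rgraph r G"
  shows "finite (snd G)"
  by (rule finite_subset[of _ "Pow (fst G)"]) (use assms in \<open>auto simp: is_rgraph_def\<close>)

lemma rgraph_card_edges_le:
  assumes "is_rgraph r G"
  shows "card (snd G) \<le> card (fst G) choose r"
proof -
  have "card (snd G) \<le> card {X. X \<subseteq> fst G \<and> card X = r}"
    by (rule card_mono) (use assms in \<open>auto simp: is_rgraph_def\<close>)
  then show ?thesis
    using n_subsets[of "fst G" r] assms by (simp add: is_rgraph_def)
qed

text \<open>Double counting: each edge is counted once at each of its \<open>r\<close>
  vertices.\<close>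

lemma sum_degree:
  assumes "is_rgraph r G"
  shows "(\<Sum>v\<in>fst G. degree G v) = r * card (snd G)"
  unfolding degree_def
proof (rule sum_multicount)
  show "\<forall>e\<in>snd G. card {v \<in> fst G. v \<in> e} = r"
  proof
    fix e assume "e \<in> snd G"
    then have "{v \<in> fst G. v \<in> e} = e" "card e = r"
      using assms by (auto simp: is_rgraph_def)
    then show "card {v \<in> fst G. v \<in> e} = r" by simp
  qed
qed (use assms rgraph_finite_edges[OF assms] in \<open>auto simp: is_rgraph_def\<close>)

lemma rgraph_delete_vertex: "is_rgraph r G \<Longrightarrow> is_rgraph r (delete_vertex G v)"
  by (auto simp: is_rgraph_def delete_vertex_def)

lemma free_delete_vertex: "is_free F G \<Longrightarrow> is_free F (delete_vertex G v)"
  unfolding contains_copy_def delete_vertex_def by fastforce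

lemma card_edges_delete_vertex:
  assumes "is_rgraph r G"
  shows "card (snd G) = card (snd (delete_vertex G v)) + degree G v"
proof -
  have "card (snd G) = card ({e \<in> snd G. v \<notin> e} \<union> {e \<in> snd G. v \<in> e})"
    by (rule arg_cong[of _ _ card]) auto
  also have "\<dots> = card {e \<in> snd G. v \<notin> e} + card {e \<in> snd G. v \<in> e}"
    by (rule card_Un_disjoint) (use rgraph_finite_edges[OF assms] in auto)
  finally show ?thesis by (simp add: delete_vertex_def degree_def)
qed

section \<open>The extremal number as a maximum, and averaging over deletions\<close>

lemma finite_free_sizes:
  "finite {card (snd G) | G :: nat hgraph. is_rgraph r G \<and> card (fst G) = n \<and> is_free F G}"
  by (rule finite_subset[of _ "{..n choose r}"]) (use rgraph_card_edges_le in auto)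

lemma ex_number_ge:
  fixes G :: "nat hgraph"
  assumes "is_rgraph r G" "is_free F G"
  shows "card (snd G) \<le> ex_number r F (card (fst G))"
  unfolding ex_number_def
proof (rule cSup_upper)
  show "card (snd G) \<in> {card (snd H) | H :: nat hgraph.
      is_rgraph r H \<and> card (fst H) = card (fst G) \<and> is_free F H}"
    using assms by blast
qed (rule bdd_above_finite[OF finite_free_sizes])

text \<open>The witness \<open>H\<close> excludes the default supremum 0 of the empty set. The set
  of sizes is then nonempty and finite, so its supremum is its maximum.\<close>

lemma ex_number_attained:
  fixes H :: "nat hgraph"
  assumes "is_rgraph r H" "is_free F H"
  obtains G :: "nat hgraph" where "is_rgraph r G" "is_free F G"
    "card (fst G) = card (fst H)" "card (snd G) = ex_number r F (card (fst H))"
proof -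
  let ?S = "{card (snd G) | G :: nat hgraph.
    is_rgraph r G \<and> card (fst G) = card (fst H) \<and> is_free F G}"
  have "?S \<noteq> {}" using assms by blast
  then have "Sup ?S \<in> ?S"
    unfolding Sup_nat_def using Max_in[OF finite_free_sizes] by (simp only: if_False)
  then show ?thesis
    using that unfolding ex_number_def by force
qed

text \<open>Deleting \<open>v\<close> from an extremal hypergraph gives
  \<open>ex(n) \<le> ex(n - 1) + degree v\<close>; these bounds are summed over all vertices, where
  the degrees add up to \<open>r * ex(n)\<close>. The additive form avoids the truncated difference
  \<open>n - r\<close>.\<close>

lemma ex_number_averaging:
  fixes H :: "nat hgraph"
  assumes "is_rgraph r H" "is_free F H" "card (fst H) = n"
  shows "n * ex_number r F n \<le> n * ex_number r F (n - 1) + r * ex_number r F n"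
proof -
  obtain G :: "nat hgraph" where G: "is_rgraph r G" "is_free F G"
    "card (fst G) = n" "card (snd G) = ex_number r F n"
    using ex_number_attained[OF assms(1,2)] assms(3) by metis
  have fin: "finite (fst G)" using G(1) by (simp add: is_rgraph_def)
  have le: "card (snd G) \<le> ex_number r F (n - 1) + degree G v" if "v \<in> fst G" for v
  proof -
    have "card (fst (delete_vertex G v)) = n - 1"
      using that fin G(3) by (simp add: delete_vertex_def)
    then show ?thesis
      using ex_number_ge[OF rgraph_delete_vertex[OF G(1), of v] free_delete_vertex[OF G(2)]]
        card_edges_delete_vertex[OF G(1), of v] by simp
  qed
  have "(\<Sum>v\<in>fst G. card (snd G)) \<le> (\<Sum>v\<in>fst G. ex_number r F (n - 1) + degree G v)"
    by (rule sum_mono) (rule le)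
  then show ?thesis
    using sum_degree[OF G(1)] G(3,4) by (simp add: sum.distrib)
qed

section \<open>Constructions and vertex duplication\<close>

lemma is_construction_imp_rgraph: "is_construction r P G \<Longrightarrow> is_rgraph r G"
  by (auto simp: is_construction_def is_rgraph_def)

text \<open>All vertices are put into part \<open>i\<close>, the other parts being empty. This
  supplies a free hypergraph of every order.\<close>

lemma construction_exists:
  assumes "i \<in> fst P"
  obtains G :: "nat hgraph" where "is_construction r P G" "card (fst G) = n"
proof -
  let ?W = "\<lambda>j. if j = i then {..<n} else {}"
  let ?G = "({..<n}, {X. X \<subseteq> {..<n} \<and> card X = r \<and> profile (fst P) ?W X \<in> snd P})"
  have "is_construction r P ?G"
    unfolding is_construction_def using assms
    by (intro conjI exI[of _ ?W]) (auto simp: disjoint_family_on_def split: if_splits)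
  then show ?thesis by (rule that) simp
qed

text \<open>A clone \<open>w\<close> of \<open>v\<close> joins the part of \<open>v\<close>. Old
  edges survive, and replacing \<open>v\<close> by \<open>w\<close> in an edge through
  \<open>v\<close> keeps its profile, hence gives a new edge. Possible edges through both
  \<open>v\<close> and \<open>w\<close> are not counted, whence only an inequality.\<close>

lemma construction_duplicate_vertex:
  assumes "is_construction r P G" "v \<in> fst G" "w \<notin> fst G"
  obtains H where "is_construction r P H" "fst H = insert w (fst G)"
    "card (snd G) + degree G v \<le> card (snd H)"
proof -
  obtain W where fin: "finite (fst G)" and disj: "disjoint_family_on W (fst P)"
    and un: "(\<Union>i\<in>fst P. W i) = fst G"
    and edges: "snd G = {X. X \<subseteq> fst G \<and> card X = r \<and> profile (fst P) W X \<in> snd P}"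
    using assms(1) by (auto simp: is_construction_def)
  obtain j where j: "j \<in> fst P" "v \<in> W j" using un assms(2) by auto
  define U where "U = W(j := insert w (W j))"
  define H where "H = (insert w (fst G),
    {X. X \<subseteq> insert w (fst G) \<and> card X = r \<and> profile (fst P) U X \<in> snd P})"
  define swap where "swap e = insert w (e - {v})" for e
  have wW: "w \<notin> W i" if "i \<in> fst P" for i using that un assms(3) by auto
  have vW: "v \<in> W i \<longleftrightarrow> i = j" if "i \<in> fst P" for i
    using that disj j by (auto simp: disjoint_family_on_def)
  have H: "is_construction r P H"
    unfolding is_construction_def
  proof (intro conjI exI[of _ U])
    show "disjoint_family_on U (fst P)"
      using disj wW by (auto simp: disjoint_family_on_def U_def)
    show "(\<Union>i\<in>fst P. U i) = fst H"
      using un j by (auto simp: U_def H_def split: if_splits)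
  qed (use fin in \<open>auto simp: H_def\<close>)
  have prof: "profile (fst P) U e = profile (fst P) W e" if "w \<notin> e" for e
    unfolding profile_def using that by (intro sum.cong) (auto simp: U_def)
  have prof_swap: "profile (fst P) U (swap e) = profile (fst P) W e"
    if e: "e \<subseteq> fst G" "v \<in> e" for e
    unfolding profile_def
  proof (rule sum.cong[OF refl])
    fix i assume i: "i \<in> fst P"
    have we: "w \<notin> e" using e assms(3) by auto
    have fe: "finite e" using e fin finite_subset by blast
    \<comment> \<open>In the part of \<open>v\<close> one vertex is exchanged for another; every
      other part contains neither \<open>v\<close> nor \<open>w\<close>.\<close>
    have "card (swap e \<inter> U i) = card (e \<inter> W i)"
    proof (cases "i = j")
      case True
      have "swap e \<inter> U i = insert w (e \<inter> W i - {v})"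
        using True by (auto simp: swap_def U_def)
      moreover have "v \<in> e \<inter> W i" using True j e by simp
      ultimately show ?thesis
        using we fe card_Suc_Diff1[of "e \<inter> W i" v] by simp
    next
      case False
      then have "swap e \<inter> U i = e \<inter> W i"
        using wW[OF i] vW[OF i] by (auto simp: swap_def U_def)
      then show ?thesis by simp
    qed
    then show "replicate_mset (card (swap e \<inter> U i)) i = replicate_mset (card (e \<inter> W i)) i"
      by simp
  qed
  let ?D = "{e \<in> snd G. v \<in> e}"
  have card_swap: "card (swap e) = card e" if "e \<subseteq> fst G" "v \<in> e" for e
    using that fin finite_subset[of e "fst G"] assms(3) card_Suc_Diff1[of e v] unfolding swap_def
    by (subst card_insert_disjoint) auto
  have sub: "snd G \<union> swap ` ?D \<subseteq> snd H"
  proof -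
    have "e \<in> snd H" if "e \<in> snd G" for e
      using that prof[of e] assms(3) by (force simp: edges H_def)
    moreover have "swap e \<in> snd H" if "e \<in> ?D" for e
      using that prof_swap[of e] card_swap[of e] by (auto simp: edges H_def swap_def)
    ultimately show ?thesis by blast
  qed
  have inj: "inj_on swap ?D"
  proof (rule inj_onI)
    fix e f assume *: "e \<in> ?D" "f \<in> ?D" "swap e = swap f"
    \<comment> \<open>An explicit inverse of \<open>swap\<close>: swapping back recovers the edge,
      because \<open>w\<close> is not a vertex of \<open>G\<close>.\<close>
    have "g = insert v (swap g - {w})" if "g \<in> ?D" for g
      using that assms(3) by (auto simp: swap_def edges)
    then show "e = f" using * by metis
  qed
  have finG: "finite (snd G)" and finH: "finite (snd H)"
    using rgraph_finite_edges is_construction_imp_rgraph assms(1) H by blast+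
  have "card (snd G) + degree G v = card (snd G) + card (swap ` ?D)"
    by (simp add: degree_def card_image[OF inj])
  also have "\<dots> = card (snd G \<union> swap ` ?D)"
  proof (rule card_Un_disjoint[symmetric])
    \<comment> \<open>Swapped edges contain \<open>w\<close>, edges of \<open>G\<close> do
      not.\<close>
    show "snd G \<inter> swap ` ?D = {}" using assms(3) by (auto simp: swap_def edges)
  qed (use finG in simp_all)
  also have "\<dots> \<le> card (snd H)" by (rule card_mono[OF finH sub])
  finally show ?thesis using that[OF H] by (simp add: H_def)
qed

text \<open>Both halves of the Turan pair enter: an extremal hypergraph is a construction, and its
  enlargement by a clone is again one, hence free. Summing over all choices of the cloned vertex
  takes the place of choosing one of maximum degree.\<close>

lemma ex_number_duplication:
  assumes "turan_pair r F P" "i \<in> fst P" "m \<ge> 1"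
  shows "m * ex_number r F m + r * ex_number r F m \<le> m * ex_number r F (m + 1)"
proof -
  obtain G0 :: "nat hgraph" where G0: "is_construction r P G0" "card (fst G0) = m"
    using construction_exists[OF assms(2)] by metis
  then have "is_rgraph r G0" "is_free F G0"
    using assms(1) is_construction_imp_rgraph unfolding turan_pair_def by blast+
  then obtain G :: "nat hgraph" where G: "is_rgraph r G" "is_free F G"
    "card (fst G) = m" "card (snd G) = ex_number r F m"
    using ex_number_attained G0(2) by metis
  then have con: "is_construction r P G"
    using assms(1) unfolding turan_pair_def by blast
  have fin: "finite (fst G)" using G(1) by (simp add: is_rgraph_def)
  then obtain w where w: "w \<notin> fst G" using ex_new_if_finite infinite_UNIV_nat by blast
  have le: "card (snd G) + degree G v \<le> ex_number r F (m + 1)" if "v \<in> fst G" for v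
  proof -
    obtain H where H: "is_construction r P H" "fst H = insert w (fst G)"
      "card (snd G) + degree G v \<le> card (snd H)"
      using construction_duplicate_vertex[OF con \<open>v \<in> fst G\<close> w] by metis
    have "is_free F H" using H(1) assms(1) unfolding turan_pair_def by blast
    then have "card (snd H) \<le> ex_number r F (card (fst H))"
      by (rule ex_number_ge[OF is_construction_imp_rgraph[OF H(1)]])
    then show ?thesis using H(2,3) fin w G(3) by simp
  qed
  have "(\<Sum>v\<in>fst G. card (snd G) + degree G v) \<le> (\<Sum>v\<in>fst G. ex_number r F (m + 1))"
    by (rule sum_mono) (rule le)
  then show ?thesis
    using sum_degree[OF G(1)] G(3,4) by (simp add: sum.distrib)
qed

section \<open>Binomial estimate and conclusion\<close>

text \<open>Two absorption identities, lowering \<open>s + 2\<close> to \<open>s\<close>. The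
  difference \<open>m - s\<close> is taken in the reals; for \<open>m < s\<close> both sides
  vanish.\<close>

lemma absorb_twice:
  "real ((s + 2) * (s + 1)) * real ((m + 1) choose (s + 2))
     = real (m + 1) * (real m - real s) * real (m choose s)"
proof -
  have "(s + 2) * ((m + 1) choose (s + 2)) = (m + 1) * (m choose (s + 1))"
    using Suc_times_binomial[of "s + 1" m] by simp
  moreover have "real (s + 1) * real (m choose (s + 1)) = (real m - real s) * real (m choose s)"
  proof (cases "s \<le> m")
    case True
    have "(s + 1) * (m choose (s + 1)) = (m - s) * (m choose s)"
      using binomial_absorb_comp[of m s] binomial_absorption[of s m] by simp
    then have "real ((s + 1) * (m choose (s + 1))) = real ((m - s) * (m choose s))" by simp
    then show ?thesis using True by (simp only: of_nat_mult of_nat_diff)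
  qed (simp add: binomial_eq_0)
  ultimately show ?thesis
    by (metis (no_types, lifting) mult.assoc mult.left_commute of_nat_mult)
qed

theorem theorem1p9:
  fixes r k :: nat and F :: "'v hgraph" and E :: "nat multiset set"
  assumes "r \<ge> 2"
    and "is_rgraph r F"
    and "k \<ge> 1"
    and "is_pattern r ({1..k}, E)"
    and "minimal_pattern r ({1..k}, E)"
    and "turan_pair r F ({1..k}, E)"
  shows "\<forall>n\<ge>2. \<bar>ex_diff r F n - avg_deg r F (n - 1)\<bar> \<le> 4 * real ((n - 1) choose (r - 2))"
proof (intro allI impI)
  fix n :: nat assume "n \<ge> 2"
  \<comment> \<open>The shift \<open>n = m + 2\<close>, \<open>r = s + 2\<close> removes truncated
    subtractions.\<close>
  define m s where "m = n - 2" and "s = r - 2"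
  have n: "n = m + 2" and r: "r = s + 2" using \<open>n \<ge> 2\<close> assms(1) by (auto simp: m_def s_def)
  let ?P = "({1..k}, E)"
  have one: "1 \<in> fst ?P" using assms(3) by simp
  have attained: "\<exists>G :: nat hgraph. is_rgraph r G \<and> is_free F G \<and> card (fst G) = l
      \<and> card (snd G) = ex_number r F l" for l
  proof -
    obtain G0 :: "nat hgraph" where G0: "is_construction r ?P G0" "card (fst G0) = l"
      using construction_exists[OF one] by metis
    then have "is_rgraph r G0" "is_free F G0"
      using assms(6) is_construction_imp_rgraph unfolding turan_pair_def by blast+
    then show ?thesis using ex_number_attained G0(2) by metis
  qed
  have bound: "ex_number r F l \<le> l choose r" for l
    using attained[of l] rgraph_card_edges_le by metis
  define a b where "a = real (ex_number r F (m + 1))" and "b = real (ex_number r F (m + 2))"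
  have a0: "a \<ge> 0" by (simp add: a_def)
  have ex_diff: "ex_diff r F n = b - a" and avg: "avg_deg r F (n - 1) = r * a / (m + 1)"
    by (simp_all add: ex_diff_def avg_deg_def a_def b_def n)
  \<comment> \<open>Lower bound: duplication in an extremal hypergraph on
    \<open>n - 1 = m + 1\<close> vertices.\<close>
  have "real ((m + 1) * ex_number r F (m + 1) + r * ex_number r F (m + 1))
      \<le> real ((m + 1) * ex_number r F (m + 1 + 1))"
    using ex_number_duplication[OF assms(6) one, of "m + 1"] by (simp only: of_nat_le_iff)
  then have "r * a \<le> (b - a) * (m + 1)"
    by (simp add: a_def b_def algebra_simps)
  then have lower: "r * a / (m + 1) \<le> b - a"
    by (simp add: pos_divide_le_eq)
  have upper: "b - a - r * a / (m + 1) \<le> real ((m + 1) choose s)"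
  proof (cases "s < m")
    case False
    \<comment> \<open>Here \<open>n \<le> r\<close>, so the averaging bound is vacuous.\<close>
    then have "(m + 2) choose (s + 2) \<le> (m + 1) choose s"
      by (cases "s = m") (simp_all add: binomial_eq_0)
    then have "ex_number r F (m + 2) \<le> (m + 1) choose s"
      using bound[of "m + 2"] r by simp
    \<comment> \<open>The trivial bound on \<open>b\<close> suffices, as both subtracted terms are
      nonnegative.\<close>
    then have "b \<le> real ((m + 1) choose s)"
      by (simp only: b_def of_nat_le_iff)
    moreover have "r * a / (m + 1) \<ge> 0" using a0 by simp
    ultimately show ?thesis using a0 by linarith
  next
    case True
    \<comment> \<open>With \<open>x\<close>, which is \<open>d(n - 1) / r\<close>, the inequalities
      become free of division.\<close>
    define x where "x = a / (m + 1)"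
    have ax: "a = (m + 1) * x" by (simp add: x_def)
    obtain G :: "nat hgraph" where "is_rgraph r G" "is_free F G" "card (fst G) = m + 2"
      using attained by blast
    then have "real ((m + 2) * ex_number r F (m + 2))
        \<le> real ((m + 2) * ex_number r F (m + 1) + r * ex_number r F (m + 2))"
      using ex_number_averaging[of r G F "m + 2"] by (simp only: of_nat_le_iff) simp
    then have "(real m + 2) * b \<le> (real m + 2) * a + (real s + 2) * b"
      by (simp add: a_def b_def r algebra_simps)
    \<comment> \<open>After substituting \<open>a = (m + 1) * x\<close>, the right-hand factor
      \<open>s + 1\<close> arises as \<open>(m + 1) - (m - s)\<close>.\<close>
    then have "(real m - real s) * (b - a - (real s + 2) * x) \<le> (real s + 2) * (real s + 1) * x"
      by (simp add: ax algebra_simps)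
    also have "\<dots> \<le> (real m - real s) * real (m choose s)"
    proof -
      \<comment> \<open>The trivial bound on \<open>a\<close>, rewritten by
        \<open>absorb_twice\<close>, produces the factor \<open>m - s\<close> needed for
        cancellation; the common factor \<open>m + 1\<close> drops out.\<close>
      have "real ((s + 2) * (s + 1)) * a \<le> real ((s + 2) * (s + 1)) * real ((m + 1) choose (s + 2))"
        unfolding a_def using bound[of "m + 1"] r by (intro mult_left_mono) auto
      then have "(m + 1) * ((real s + 2) * (real s + 1) * x)
          \<le> (m + 1) * ((real m - real s) * real (m choose s))"
        unfolding absorb_twice ax by (simp add: algebra_simps)
      then show ?thesis by (rule mult_left_le_imp_le) simp
    qed
    \<comment> \<open>Cancelling \<open>m - s\<close> requires it to be positive, which is the case
      assumption.\<close>
    finally have "b - a - (real s + 2) * x \<le> real (m choose s)"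
      by (rule mult_left_le_imp_le) (use True in simp)
    also have "\<dots> \<le> real ((m + 1) choose s)"
      by (cases s) simp_all
    finally show ?thesis by (simp add: x_def r algebra_simps)
  qed
  show "\<bar>ex_diff r F n - avg_deg r F (n - 1)\<bar> \<le> 4 * real ((n - 1) choose (r - 2))"
  proof -
    \<comment> \<open>The difference lies between 0 and one copy of the binomial coefficient; since
      that is nonnegative, the bound with factor 4 follows.\<close>
    have "real ((m + 1) choose s) = real ((n - 1) choose (r - 2))" by (simp add: n r)
    moreover have "0 \<le> real ((m + 1) choose s)" by simp
    ultimately show ?thesis
      using lower upper unfolding ex_diff avg by linarith
  qed
qed

end
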